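(* Let $A,B\subseteq\mathbb{Z}$ with $\mathrm{BD}(A)=\alpha>0$ and $\mathrm{BD}(B)=\beta>0$, and let $k=\lfloor 1/(\alpha\beta)\rfloor$. Then there exists a finite set $F\subset\mathbb{Z}$ with $|F|\le k$ such that $(A-B)+F$ is thick, and hence $A-B$ is piecewise syndetic.
   Context: The upper Banach density of $A\subseteq\mathbb{Z}$ is $\mathrm{BD}(A)=\lim_{n\to\infty}\max_{x\in\mathbb{Z}}\frac{|A\cap[x+1,x+n]|}{n}$ (equivalently the infimum over $n\ge1$ of the same quantity). $A-B=\{a-b\mid a\in A,\ b\in B\}$ and $C+F=\{c+f\mid c\in C,\ f\in F\}$. A set of integers is thick if it includes arbitrarily long finite intervals; it is syndetic if it has bounded gaps, i.e. its complement in $\mathbb{Z}$ is not thick; it is piecewise syndetic if it is the intersection of a syndetic set and a thick set. *)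

theory Defs
  imports "HOL-Analysis.Analysis" "HOL-Library.Set_Algebras"
begin

text \<open>The maximum ranges over all integers \<open>x\<close>, but the cardinalities involved are bounded by
  \<open>n\<close>, so they form a finite set.\<close>

definition max_count :: "int set \<Rightarrow> nat \<Rightarrow> nat" where
  "max_count A n = Max (range (\<lambda>x. card (A \<inter> {x + 1..x + int n})))"

lemma card_window_le: "card (A \<inter> {x + 1..x + int n}) \<le> n"
proof -
  have "card (A \<inter> {x + 1..x + int n}) \<le> card {x + 1..x + int n}"
    by (intro card_mono) auto
  then show ?thesis by simp
qed

lemma finite_window_counts: "finite (range (\<lambda>x. card (A \<inter> {x + 1..x + int n})))"
  by (rule finite_subset[of _ "{..n}"]) (auto intro: card_window_le)

lemma card_window_le_max_count: "card (A \<inter> {x + 1..x + int n}) \<le> max_count A n"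
  unfolding max_count_def by (rule Max_ge[OF finite_window_counts]) auto

lemma max_count_attained: "\<exists>x. max_count A n = card (A \<inter> {x + 1..x + int n})"
  using Max_in[OF finite_window_counts[of A n]] unfolding max_count_def by auto

definition BD :: "int set \<Rightarrow> real" where
  "BD A = lim (\<lambda>n. real (max_count A n) / real n)"

text \<open>The limit exists for every set: \<open>max_count A\<close> is subadditive, so Fekete's argument applies.\<close>

lemma max_count_le: "max_count A n \<le> n"
  using max_count_attained[of A n] card_window_le by metis

lemma max_count_add: "max_count A (m + n) \<le> max_count A m + max_count A n"
proof -
  obtain x where x: "max_count A (m + n) = card (A \<inter> {x + 1..x + int (m + n)})"
    using max_count_attained by blast
  have eq: "A \<inter> {x + 1..x + int (m + n)} =
      (A \<inter> {x + 1..x + int m}) \<union> (A \<inter> {(x + int m) + 1..(x + int m) + int n})"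
    by auto
  have "max_count A (m + n) \<le>
      card (A \<inter> {x + 1..x + int m}) + card (A \<inter> {(x + int m) + 1..(x + int m) + int n})"
    unfolding x eq by (rule card_Un_le)
  also have "\<dots> \<le> max_count A m + max_count A n"
    by (intro add_mono card_window_le_max_count)
  finally show ?thesis .
qed

lemma max_count_mult_add: "max_count A (q * m + r) \<le> q * max_count A m + r"
proof (induction q)
  case 0
  then show ?case using max_count_le by simp
next
  case (Suc q)
  have "max_count A (Suc q * m + r) \<le> max_count A m + max_count A (q * m + r)"
    using max_count_add[of A m "q * m + r"] by (simp add: add.assoc)
  with Suc show ?case by simp
qed

lemma BD_LIMSEQ: "(\<lambda>n. real (max_count A n) / real n) \<longlonglongrightarrow> BD A"
  and BD_eq_Inf: "BD A = (INF n\<in>{1..}. real (max_count A n) / real n)"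
proof -
  let ?f = "\<lambda>n. real (max_count A n) / real n"
  define L where "L = (INF n\<in>{1..}. ?f n)"
  have bdd: "bdd_below (?f ` {1..})" by (rule bdd_belowI[of _ 0]) auto
  have lower: "L \<le> ?f n" if "n \<ge> 1" for n
    unfolding L_def by (rule cINF_lower[OF bdd]) (use that in auto)
  have lim: "?f \<longlonglongrightarrow> L"
  proof (rule LIMSEQ_I)
    fix e :: real assume e: "e > 0"
    have "\<exists>m\<in>{1..}. ?f m < L + e / 2"
      using cINF_less_iff[of "{1::nat..}" ?f "L + e/2"] bdd e unfolding L_def by auto
    then obtain m where m: "m \<ge> 1" "?f m < L + e / 2" by auto
    obtain N :: nat where N: "2 * real m / e < real N" using reals_Archimedean2 by blast
    have "norm (?f n - L) < e" if n: "n \<ge> max 1 N" for n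
    proof -
      have n1: "real n \<ge> 1" using n by simp
      have "max_count A n \<le> (n div m) * max_count A m + n mod m"
        using max_count_mult_add[of A "n div m" m "n mod m"] by simp
      then have "real (max_count A n) \<le> real ((n div m) * max_count A m + n mod m)"
        by (rule of_nat_mono)
      also have "\<dots> \<le> real (n div m) * real (max_count A m) + real m"
        using m(1) by (simp add: less_imp_le)
      also have "real (n div m) * real (max_count A m) \<le> real n / real m * real (max_count A m)"
        by (intro mult_right_mono of_nat_div_le_of_nat) auto
      finally have "real (max_count A n) \<le> real n * ?f m + real m" by simp
      then have "?f n \<le> ?f m + real m / real n"
        using n1 by (simp add: field_simps)
      moreover have "real m / real n < e / 2"
      proof -
        have "2 * real m / e < real n" using N n by linarith
        then show ?thesis using e n1 by (simp add: field_simps)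
      qed
      moreover have "L \<le> ?f n" using lower n by simp
      ultimately show ?thesis using m(2) unfolding real_norm_def by linarith
    qed
    then show "\<exists>no. \<forall>n\<ge>no. norm (?f n - L) < e" by blast
  qed
  have "BD A = L" unfolding BD_def by (rule limI[OF lim])
  with lim show "?f \<longlonglongrightarrow> BD A" "BD A = (INF n\<in>{1..}. ?f n)"
    by (simp_all add: L_def)
qed

text \<open>On sets, \<open>+\<close> is the elementwise sum, but \<open>-\<close> is the set-theoretic difference; hence a
  separate name for \<open>{a - b | a \<in> A, b \<in> B}\<close>.\<close>

definition diff_set :: "int set \<Rightarrow> int set \<Rightarrow> int set" where
  "diff_set A B = {a - b | a b. a \<in> A \<and> b \<in> B}"

definition thick :: "int set \<Rightarrow> bool" where
  "thick A \<longleftrightarrow> (\<forall>n::nat. \<exists>x. {x + 1..x + int n} \<subseteq> A)"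

definition syndetic :: "int set \<Rightarrow> bool" where
  "syndetic A \<longleftrightarrow> \<not> thick (- A)"

lemma syndetic_iff_bounded_gaps:
  "syndetic A \<longleftrightarrow> (\<exists>n::nat. \<forall>x. A \<inter> {x + 1..x + int n} \<noteq> {})"
  unfolding syndetic_def thick_def by blast

definition piecewise_syndetic :: "int set \<Rightarrow> bool" where
  "piecewise_syndetic A \<longleftrightarrow> (\<exists>S T. syndetic S \<and> thick T \<and> A = S \<inter> T)"

end

theory Submission
  imports Defs "HOL-Real_Asymp.Real_Asymp"
begin

text \<open>Write \<open>\<alpha> = BD A\<close> and \<open>\<beta> = BD B\<close>. Averaging over all shifts shows that a suitable
  translate of \<open>A\<close> meets \<open>B\<close> in a set \<open>C\<^sub>M\<close> that lies in a window of length \<open>M\<close> and has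
  relative density almost \<open>\<alpha> * \<beta>\<close> there (\<open>dense_shifted_intersection\<close>). Up to translation,
  \<open>A - B\<close> includes \<open>D\<^sub>M = C\<^sub>M - C\<^sub>M\<close>, so it suffices to find one small \<open>F\<close> such that the sets
  \<open>D\<^sub>M + F\<close> cover arbitrarily long intervals around a fixed place.

  Call \<open>F\<close> separated at \<open>M\<close> if the translates \<open>C\<^sub>M + f\<close> with \<open>f \<in> F\<close> are disjoint, that is, if no
  two distinct elements of \<open>F\<close> differ by an element of \<open>D\<^sub>M\<close>. If a fixed \<open>F\<close> is separated for
  infinitely many \<open>M\<close>, then comparing the size of the union of these translates with the length
  of the window bounds \<open>card F\<close> by \<open>1 / (\<alpha> * \<beta>)\<close> (\<open>separated_card_bound\<close>). Take such an \<open>F\<close> of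
  largest cardinality. For each integer \<open>x\<close> outside \<open>F\<close>, adding \<open>x\<close> to \<open>F\<close> destroys separation at all but
  finitely many of those \<open>M\<close>, and this means \<open>x \<in> D\<^sub>M + F\<close>;
  elements of \<open>F\<close> are covered because \<open>0 \<in> D\<^sub>M\<close> for \<open>M > 0\<close>. Finitely many \<open>x\<close> can be
  treated at the same \<open>M\<close>, so every finite interval lies in some \<open>D\<^sub>M + F\<close>
  (\<open>differences_cover_after_translates\<close>).
  The point of asking for infinitely many \<open>M\<close>, rather than maximising at each \<open>M\<close> separately, is
  that \<open>F\<close> then does not depend on the interval to be covered.

  Once finitely many translates of \<open>A - B\<close> have a thick union \<open>T\<close>, the set \<open>A - B\<close> meets every long
  interval inside \<open>T\<close>, which makes it piecewise syndetic
  (\<open>piecewise_syndetic_if_thick_translates\<close>).\<close>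

section \<open>Thickness and piecewise syndeticity\<close>

lemma finite_int_set_bounded:
  assumes "finite (F :: int set)"
  obtains r :: nat where "F \<subseteq> {- int r..int r}"
proof -
  have "\<exists>r::nat. F \<subseteq> {- int r..int r}"
    using assms
  proof induction
    case (insert f F)
    then obtain r :: nat where "F \<subseteq> {- int r..int r}" by blast
    then have "insert f F \<subseteq> {- int (max r (nat \<bar>f\<bar>))..int (max r (nat \<bar>f\<bar>))}" by force
    then show ?case by blast
  qed simp
  then show ?thesis using that by blast
qed

text \<open>With \<open>T = D + F\<close>, the set \<open>D\<close> is the intersection of \<open>D \<union> T\<close> and \<open>D \<union> - T\<close>. A gap of the
  latter is an interval inside \<open>T\<close> that avoids \<open>D\<close>; it is short because each of its points is
  within distance \<open>max \<bar>f\<bar>\<close>, over \<open>f \<in> F\<close>, of \<open>D\<close>.\<close>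

lemma piecewise_syndetic_if_thick_translates:
  assumes "finite F" and "thick (D + F)"
  shows "piecewise_syndetic D"
proof -
  obtain r :: nat where r: "F \<subseteq> {- int r..int r}"
    using finite_int_set_bounded[OF assms(1)] .
  have "syndetic (D \<union> - (D + F))"
    unfolding syndetic_iff_bounded_gaps
  proof (intro exI allI notI)
    fix x
    assume gap: "(D \<union> - (D + F)) \<inter> {x + 1..x + int (2 * r + 1)} = {}"
    have "x + 1 + int r \<in> {x + 1..x + int (2 * r + 1)}" by simp
    with gap have "x + 1 + int r \<in> D + F" by blast
    then obtain d f where df: "d \<in> D" "f \<in> F" "x + 1 + int r = d + f"
      by (auto elim: set_plus_elim)
    have "d \<in> {x + 1..x + int (2 * r + 1)}" using df r by auto
    with df(1) gap show False by blast
  qed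
  moreover have "thick (D \<union> (D + F))"
    using assms(2) unfolding thick_def by blast
  moreover have "D = (D \<union> - (D + F)) \<inter> (D \<union> (D + F))" by blast
  ultimately show ?thesis unfolding piecewise_syndetic_def by blast
qed

section \<open>A dense intersection with a translate\<close>

text \<open>Each pair in \<open>A \<times> B\<close> is counted by exactly one shift, and at most \<open>N + M\<close> shifts make the
  two windows overlap; some shift does at least as well as the average.\<close>

lemma popular_shift:
  fixes A B :: "int set"
  assumes A: "A \<subseteq> {x + 1..x + int N}" and B: "B \<subseteq> {y + 1..y + int M}"
  shows "\<exists>t. card A * card B \<le> (N + M) * card {b \<in> B. b + t \<in> A}"
proof (rule ccontr)
  assume "\<not> ?thesis"
  then have less: "(N + M) * card {b \<in> B. b + t \<in> A} < card A * card B" for t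
    by (simp add: not_le)
  define T where "T = {x - y - int M..<x - y + int N}"
  have cT: "card T = N + M" unfolding T_def by simp
  have fin: "finite A" "finite B" "finite T"
    using A B by (auto intro: finite_subset simp: T_def)
  have "card A * card B = (\<Sum>b\<in>B. card A)" by simp
  also have "\<dots> = (\<Sum>b\<in>B. card {t \<in> T. b + t \<in> A})"
  proof (rule sum.cong)
    fix b assume b: "b \<in> B"
    have "bij_betw (\<lambda>t. b + t) {t \<in> T. b + t \<in> A} A"
    proof (rule bij_betw_byWitness[where f' = "\<lambda>a. a - b"])
      show "(\<lambda>a. a - b) ` A \<subseteq> {t \<in> T. b + t \<in> A}"
        using A B b by (force simp: T_def)
    qed auto
    from bij_betw_same_card[OF this] show "card A = card {t \<in> T. b + t \<in> A}" ..
  qed simp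
  also have "\<dots> = (\<Sum>b\<in>B. \<Sum>t\<in>T. if b + t \<in> A then 1 else 0)"
    using fin by (simp add: sum.If_cases Int_def)
  also have "\<dots> = (\<Sum>t\<in>T. \<Sum>b\<in>B. if b + t \<in> A then 1 else 0)" by (rule sum.swap)
  also have "\<dots> = (\<Sum>t\<in>T. card {b \<in> B. b + t \<in> A})"
    using fin by (simp add: sum.If_cases Int_def)
  finally have total: "card A * card B = (\<Sum>t\<in>T. card {b \<in> B. b + t \<in> A})" .
  have "T \<noteq> {}" using less[of 0] total by auto
  have "(N + M) * (\<Sum>t\<in>T. card {b \<in> B. b + t \<in> A})
      = (\<Sum>t\<in>T. (N + M) * card {b \<in> B. b + t \<in> A})"
    by (rule sum_distrib_left)
  also have "\<dots> < (\<Sum>t\<in>T. card A * card B)"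
    using fin \<open>T \<noteq> {}\<close> less by (intro sum_strict_mono) auto
  also have "\<dots> = (N + M) * (card A * card B)" using cT by simp
  finally show False using total by simp
qed

lemma BD_le_max_count: "BD A * real n \<le> real (max_count A n)"
proof (cases "n = 0")
  case False
  have "bdd_below ((\<lambda>n. real (max_count A n) / real n) ` {1..})"
    by (rule bdd_belowI[of _ 0]) auto
  then have "BD A \<le> real (max_count A n) / real n"
    unfolding BD_eq_Inf by (rule cINF_lower) (use False in auto)
  with False show ?thesis by (simp add: field_simps)
qed simp

text \<open>The window for \<open>A\<close> has length \<open>M\<^sup>2\<close>, so the loss \<open>N / (N + M)\<close> at its boundary tends to \<open>1\<close>;
  it is the factor \<open>M / (M + 1)\<close> in the conclusion.\<close>

lemma dense_shifted_intersection:
  assumes "BD A \<ge> 0" and "BD B \<ge> 0"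
  shows "\<exists>t y C. C \<subseteq> {y + 1..y + int M} \<and> C \<subseteq> B \<and> (\<forall>c\<in>C. c + t \<in> A) \<and>
    BD A * BD B * (real M)\<^sup>2 \<le> (real M + 1) * real (card C)"
proof (cases "M = 0")
  case True
  then show ?thesis by (intro exI[of _ "{}"] exI[of _ 0]) simp
next
  case False
  obtain x where x: "max_count A (M * M) = card (A \<inter> {x + 1..x + int (M * M)})"
    using max_count_attained by blast
  obtain y where y: "max_count B M = card (B \<inter> {y + 1..y + int M})"
    using max_count_attained by blast
  obtain t where t: "max_count A (M * M) * max_count B M \<le> (M * M + M) *
      card {b \<in> B \<inter> {y + 1..y + int M}. b + t \<in> A \<inter> {x + 1..x + int (M * M)}}"
    using popular_shift[of "A \<inter> {x + 1..x + int (M * M)}" x "M * M" "B \<inter> {y + 1..y + int M}" y M]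
    unfolding x y by auto
  define C where "C = {b \<in> B \<inter> {y + 1..y + int M}. b + t \<in> A \<inter> {x + 1..x + int (M * M)}}"
  have "(BD A * real (M * M)) * (BD B * real M)
      \<le> real (max_count A (M * M)) * real (max_count B M)"
    using assms by (intro mult_mono BD_le_max_count) auto
  also have "\<dots> \<le> real ((M * M + M) * card C)"
    using t unfolding C_def[symmetric] of_nat_mult[symmetric] by (rule of_nat_mono)
  finally have "real M * (BD A * BD B * (real M)\<^sup>2) \<le> real M * ((real M + 1) * real (card C))"
    by (simp add: algebra_simps power2_eq_square)
  then have "BD A * BD B * (real M)\<^sup>2 \<le> (real M + 1) * real (card C)"
    using False by (simp add: mult_le_cancel_left)
  moreover have "C \<subseteq> {y + 1..y + int M}" "C \<subseteq> B" "\<forall>c\<in>C. c + t \<in> A"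
    unfolding C_def by auto
  ultimately show ?thesis by blast
qed

section \<open>Packing and covering by translates\<close>

text \<open>Separation of \<open>F\<close> says that the translates \<open>C + f\<close> with \<open>f \<in> F\<close> are pairwise disjoint; the form
  with differences turns a failure of it directly into a covering relation.\<close>

abbreviation separated :: "int set \<Rightarrow> int set \<Rightarrow> bool" where
  "separated C F \<equiv> pairwise (\<lambda>f g. f - g \<notin> diff_set C C) F"

lemma diff_set_self_minus: "- x \<in> diff_set C C \<longleftrightarrow> x \<in> diff_set C C"
proof -
  have "- x \<in> diff_set C C" if "x \<in> diff_set C C" for x
  proof -
    from that obtain c d where "c \<in> C" "d \<in> C" "x = c - d" unfolding diff_set_def by blast
    then have "- x = d - c" by simp
    with \<open>c \<in> C\<close> \<open>d \<in> C\<close> show ?thesis unfolding diff_set_def by blast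
  qed
  from this[of x] this[of "- x"] show ?thesis by auto
qed

lemma separated_card_mult_le:
  assumes C: "C \<subseteq> {y + 1..y + int M}" and F: "F \<subseteq> {- int r..int r}" and sep: "separated C F"
  shows "card F * card C \<le> M + 2 * r"
proof -
  have "inj_on (\<lambda>(f, c). f + c) (F \<times> C)"
  proof (rule inj_onI, clarify)
    fix f c g d
    assume *: "f \<in> F" "c \<in> C" "g \<in> F" "d \<in> C" "f + c = g + d"
    then have "f - g = d - c" by simp
    with *(2,4) have "f - g \<in> diff_set C C" unfolding diff_set_def by blast
    then have "f = g" using sep * unfolding pairwise_def by blast
    then show "f = g \<and> c = d" using * by simp
  qed
  then have "card F * card C = card ((\<lambda>(f, c). f + c) ` (F \<times> C))"
    by (simp add: card_image card_cartesian_product)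
  also have "\<dots> \<le> card {y + 1 - int r..y + int M + int r}"
  proof (intro card_mono subsetI)
    fix z assume "z \<in> (\<lambda>(f, c). f + c) ` (F \<times> C)"
    then obtain f c where "z = f + c" "f \<in> F" "c \<in> C" by auto
    moreover from this have "f \<in> {- int r..int r}" "c \<in> {y + 1..y + int M}"
      using C F by blast+
    ultimately show "z \<in> {y + 1 - int r..y + int M + int r}" by simp
  qed simp
  finally show ?thesis by simp
qed

text \<open>Since \<open>F\<close> is fixed while \<open>M\<close> grows, the diameter of \<open>F\<close> is negligible against the window, and
  \<open>card F\<close> disjoint copies of density \<open>\<delta>\<close> give \<open>card F * \<delta> \<le> 1\<close> in the limit.\<close>

lemma separated_card_bound:
  assumes C: "\<And>M. C M \<subseteq> {y M + 1..y M + int M}"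
    and dense: "\<And>M. \<delta> * (real M)\<^sup>2 \<le> (real M + 1) * real (card (C M))"
    and F: "finite F" and sep: "\<exists>\<^sub>\<infinity>M. separated (C M) F"
  shows "real (card F) * \<delta> \<le> 1"
proof (rule ccontr)
  assume "\<not> ?thesis"
  then have gt: "1 < real (card F) * \<delta>" by simp
  obtain r :: nat where r: "F \<subseteq> {- int r..int r}"
    using finite_int_set_bounded[OF F] .
  have "(\<lambda>M. (real M + 1) * (real M + 2 * real r) / (real M)\<^sup>2) \<longlonglongrightarrow> 1" by real_asymp
  from order_tendstoD(2)[OF this gt] have "\<forall>\<^sub>F M in sequentially.
      (real M + 1) * (real M + 2 * real r) / (real M)\<^sup>2 < real (card F) * \<delta>" .
  then have "\<forall>\<^sub>F M in sequentially. \<not> separated (C M) F"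
    using eventually_gt_at_top[of 0]
  proof eventually_elim
    case (elim M)
    show ?case
    proof
      assume "separated (C M) F"
      from separated_card_mult_le[OF C r this]
      have size: "real (card F) * real (card (C M)) \<le> real M + 2 * real r"
        by (metis of_nat_add of_nat_mono of_nat_mult of_nat_numeral)
      have "real (card F) * \<delta> * (real M)\<^sup>2 = real (card F) * (\<delta> * (real M)\<^sup>2)" by simp
      also have "\<dots> \<le> real (card F) * ((real M + 1) * real (card (C M)))"
        by (intro mult_left_mono dense) simp
      also have "\<dots> = (real M + 1) * (real (card F) * real (card (C M)))" by simp
      also have "\<dots> \<le> (real M + 1) * (real M + 2 * real r)"
        by (intro mult_left_mono size) simp
      finally show False using elim by (simp add: field_simps)
    qed
  qed
  with sep show False
    unfolding cofinite_eq_sequentially[symmetric] frequently_def by simp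
qed

text \<open>A largest \<open>F\<close> among those separated for infinitely many \<open>M\<close> works: for \<open>M > 0\<close>, an integer \<open>x\<close> outside
  \<open>C M - C M + F\<close> could be added to \<open>F\<close> at this \<open>M\<close>, and by maximality this happens for only
  finitely many of those \<open>M\<close>.\<close>

lemma differences_cover_after_translates:
  assumes C: "\<And>M. C M \<subseteq> {y M + 1..y M + int M}"
    and dense: "\<And>M. \<delta> * (real M)\<^sup>2 \<le> (real M + 1) * real (card (C M))"
    and \<delta>: "\<delta> > 0"
  shows "\<exists>F. finite F \<and> real (card F) \<le> 1 / \<delta> \<and>
    (\<forall>X. finite X \<longrightarrow> (\<exists>M. X \<subseteq> diff_set (C M) (C M) + F))"
proof -
  define P where "P F \<longleftrightarrow> finite F \<and> (\<exists>\<^sub>\<infinity>M. separated (C M) F)" for F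
  have bound: "real (card F) \<le> 1 / \<delta>" if "P F" for F
    using separated_card_bound[OF C dense, of F] that \<delta> unfolding P_def by (simp add: field_simps)
  have "P {}" unfolding P_def by simp
  moreover have "\<forall>F. P F \<longrightarrow> card F < Suc (nat \<lfloor>1 / \<delta>\<rfloor>)"
    using bound by (auto simp: less_Suc_eq_le le_nat_floor)
  ultimately obtain F where F: "P F" and maximal: "\<And>G. P G \<Longrightarrow> card G \<le> card F"
    using ex_has_greatest_nat[of P "{}" card] by blast
  have "\<exists>M. X \<subseteq> diff_set (C M) (C M) + F" if X: "finite X" for X
  proof -
    have "\<forall>\<^sub>\<infinity>M. separated (C M) F \<longrightarrow> x \<in> diff_set (C M) (C M) + F" for x
    proof (cases "x \<in> F")
      case True
      \<comment> \<open>For \<open>M = 0\<close> the set \<open>C M\<close> is empty and \<open>0\<close> is not a difference.\<close>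
      have "\<forall>\<^sub>\<infinity>M::nat. M > 0" by (simp add: cofinite_eq_sequentially eventually_gt_at_top)
      then show ?thesis
      proof eventually_elim
        case (elim M)
        have "0 < \<delta> * (real M)\<^sup>2" using elim \<delta> by simp
        then have "0 < (real M + 1) * real (card (C M))" using dense[of M] by linarith
        then have "C M \<noteq> {}" by auto
        then have "0 \<in> diff_set (C M) (C M)" unfolding diff_set_def by auto
        from set_plus_intro[OF this True] show ?case by simp
      qed
    next
      case False
      then have "card (insert x F) = Suc (card F)" using F unfolding P_def by simp
      with maximal[of "insert x F"] have "\<not> P (insert x F)" by linarith
      then have "\<forall>\<^sub>\<infinity>M. \<not> separated (C M) (insert x F)"
        using F unfolding P_def not_frequently by simp
      then show ?thesis
      proof eventually_elim
        case (elim M)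
        show ?case
        proof
          assume "separated (C M) F"
          with elim obtain f where f: "f \<in> F"
            "x - f \<in> diff_set (C M) (C M) \<or> f - x \<in> diff_set (C M) (C M)"
            unfolding pairwise_insert by blast
          then have "x - f \<in> diff_set (C M) (C M)"
            using diff_set_self_minus[of "f - x" "C M"] by auto
          from set_plus_intro[OF this f(1)] show "x \<in> diff_set (C M) (C M) + F" by simp
        qed
      qed
    qed
    then have "\<forall>\<^sub>\<infinity>M. \<forall>x\<in>X. separated (C M) F \<longrightarrow> x \<in> diff_set (C M) (C M) + F"
      by (intro eventually_ball_finite[OF X] ballI)
    moreover have "\<exists>\<^sub>\<infinity>M. separated (C M) F" using F unfolding P_def by blast
    ultimately have "\<exists>\<^sub>\<infinity>M. separated (C M) F \<and>
        (\<forall>x\<in>X. separated (C M) F \<longrightarrow> x \<in> diff_set (C M) (C M) + F)"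
      by (rule frequently_eventually_frequently[rotated])
    from frequently_ex[OF this] show ?thesis by blast
  qed
  with F bound show ?thesis unfolding P_def by blast
qed

section \<open>Thickness of finitely many translates of the difference set\<close>

theorem corollary5p6:
  fixes A B :: "int set" and \<alpha> \<beta> :: real and k :: int
  assumes "BD A = \<alpha>" and "\<alpha> > 0"
    and "BD B = \<beta>" and "\<beta> > 0"
    and "k = \<lfloor>1 / (\<alpha> * \<beta>)\<rfloor>"
  shows "(\<exists>F :: int set. finite F \<and> int (card F) \<le> k \<and> thick (diff_set A B + F))
    \<and> piecewise_syndetic (diff_set A B)"
proof -
  have "\<forall>M. \<exists>t y C. C \<subseteq> {y + 1..y + int M} \<and> C \<subseteq> B \<and> (\<forall>c\<in>C. c + t \<in> A) \<and>
      \<alpha> * \<beta> * (real M)\<^sup>2 \<le> (real M + 1) * real (card C)"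
    using dense_shifted_intersection[of A B] assms by simp
  then obtain t y C where C: "\<And>M. C M \<subseteq> {y M + 1..y M + int M}"
    and CB: "\<And>M. C M \<subseteq> B" and CA: "\<And>M c. c \<in> C M \<Longrightarrow> c + t M \<in> A"
    and dense: "\<And>M. \<alpha> * \<beta> * (real M)\<^sup>2 \<le> (real M + 1) * real (card (C M))"
    by metis
  have "\<alpha> * \<beta> > 0" using assms by simp
  from differences_cover_after_translates[OF C dense this]
  obtain F where F: "finite F" "real (card F) \<le> 1 / (\<alpha> * \<beta>)"
    and cover: "\<And>X. finite X \<Longrightarrow> \<exists>M. X \<subseteq> diff_set (C M) (C M) + F"
    by blast
  have thick: "thick (diff_set A B + F)"
    unfolding thick_def
  proof
    fix n :: nat
    obtain M where M: "{1..int n} \<subseteq> diff_set (C M) (C M) + F"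
      using cover[of "{1..int n}"] by auto
    have "{t M + 1..t M + int n} \<subseteq> diff_set A B + F"
    proof
      fix z assume "z \<in> {t M + 1..t M + int n}"
      then have "z - t M \<in> diff_set (C M) (C M) + F" using M by auto
      then obtain c d f where "c \<in> C M" "d \<in> C M" "f \<in> F" "z - t M = (c - d) + f"
        unfolding diff_set_def by (auto elim!: set_plus_elim)
      moreover from this have "(c + t M) - d \<in> diff_set A B"
        unfolding diff_set_def using CA CB by blast
      moreover have "z = ((c + t M) - d) + f" using \<open>z - t M = (c - d) + f\<close> by simp
      ultimately show "z \<in> diff_set A B + F" by (metis set_plus_intro)
    qed
    then show "\<exists>x. {x + 1..x + int n} \<subseteq> diff_set A B + F" by blast
  qed
  have "int (card F) \<le> k" using F(2) assms(5) by (simp add: le_floor_iff)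
  then show ?thesis
    using F(1) thick piecewise_syndetic_if_thick_translates[OF F(1) thick] by blast
qed

end
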